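(* On $\mathbb{R}^3$ (with coordinates $x,y,z$), any affine Poisson structure is isomorphic to one of the following forms, where $a>0$ is a constant: (A) $k=0$ (unimodular case): - (1) quadratic function $f=0$: $\frac{\partial}{\partial x}\wedge\frac{\partial}{\partial y}$. - (2) $f=x^2+y^2+z^2$: $\pi_f$. - (3) $f=x^2+y^2-z^2$: $\pi_f$. - (4) $f=x^2+y^2$: $\frac{\partial}{\partial x}\wedge\frac{\partial}{\partial y}+\pi_f$. - (5) $f=x^2-y^2$: $\frac{\partial}{\partial x}\wedge\frac{\partial}{\partial y}+\pi_f$. - (6) $f=x^2$: $\frac{\partial}{\partial x}\wedge\frac{\partial}{\partial y}+\pi_f$. (B) $k=(0,0,1)^T$, i.e. $\hat k=\frac{\partial}{\partial z}$: - (7) $f=0$: $\pi_{k,f}$. - (8) $f=a(x^2+y^2)$: $\pi_{k,f}$. - (9)$_1$ $f=a(x^2-y^2)$, $a\neq\frac14$: $\pi_{k,f}$. - (9)$_2$ $f=\frac14(x^2-y^2)$: $\frac{\partial}{\partial z}\wedge\frac{\partial}{\partial x}+\pi_{k,f}$. - (10) $f=x^2$: $\pi_{k,f}$.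
   Context: An affine Poisson structure (modified Lie–Poisson structure) on $\mathbb{R}^3$ is a Poisson bivector field whose coefficients in the linear coordinates are affine (degree at most one) functions, i.e. the sum of a linear bivector field and a constant one. Equivalently, its linear part is the Lie–Poisson structure of a $3$-dimensional Lie algebra $\mathfrak{g}$ (on $\mathfrak{g}^*\cong\mathbb{R}^3$) and its constant part is a $2$-cocycle of $\mathfrak{g}$ with trivial coefficients; thus these structures correspond to central extensions of $\mathfrak{g}$ by $\mathbb{R}$. Isomorphic means related by an invertible affine transformation of $\mathbb{R}^3$. For $k\in\mathbb{R}^3$ and a homogeneous quadratic function $f$ on $\mathbb{R}^3$ with $\hat kf=0$, the associated linear Poisson structure is $$\pi_{k,f}=\tfrac12\hat I\wedge\hat k+\pi_f,\qquad \pi_f=\frac{\partial f}{\partial x}\frac{\partial}{\partial y}\wedge\frac{\partial}{\partial z}+\frac{\partial f}{\partial y}\frac{\partial}{\partial z}\wedge\frac{\partial}{\partial x}+\frac{\partial f}{\partial z}\frac{\partial}{\partial x}\wedge\frac{\partial}{\partial y},$$ where $\hat I=x\frac{\partial}{\partial x}+y\frac{\partial}{\partial y}+z\frac{\partial}{\partial z}$ and $\hat k$ is the constant vector field $k$. The vector $k$ is the modular vector of $\pi_{k,f}$; when $k=0$, $\pi_{k,f}=\pi_f$.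
   Formalization: The list as stated omits some affine Poisson structures (e.g. the zero one); the formal theorem adds five linear forms: 0, π_f for f=x²+y², x²−y², x² (k=0), and π_{k,f} for f=¼(x²−y²), i.e. the linear parts of (1), (4), (5), (6), (9)₂. *)

theory Defs
  imports "HOL-Analysis.Analysis"
begin

text \<open>A bivector on the space of real triples is encoded as the skew matrix of its values on the
  coordinate differentials: for a bivector field \<open>\<pi>\<close>, the entry \<open>\<pi> p $ i $ j\<close> is the bracket of the
  \<open>i\<close>-th and \<open>j\<close>-th coordinate functions at \<open>p\<close>.  The coordinates \<open>x, y, z\<close> are
  \<open>p $ 1, p $ 2, p $ 3\<close>.\<close>

type_synonym bivector_field = "real^3 \<Rightarrow> real^3^3"

definition bivector_field :: "bivector_field \<Rightarrow> bool" where
  "bivector_field \<pi> \<longleftrightarrow> (\<forall>p. transpose (\<pi> p) = - \<pi> p)"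

definition wedge :: "real^3 \<Rightarrow> real^3 \<Rightarrow> real^3^3" where
  "wedge u v = (\<chi> i j. u $ i * v $ j - u $ j * v $ i)"

definition partial :: "3 \<Rightarrow> (real^3 \<Rightarrow> real) \<Rightarrow> real^3 \<Rightarrow> real" where
  "partial i f p = frechet_derivative f (at p) (axis i 1)"

text \<open>Vanishing of the Schouten bracket of \<open>\<pi>\<close> with itself, in coordinates; equivalently the Jacobi
  identity for the bracket of functions.  The partial derivatives are meaningful only for
  differentiable \<open>\<pi>\<close>, which is automatic in the affine case considered below.\<close>

definition poisson :: "bivector_field \<Rightarrow> bool" where
  "poisson \<pi> \<longleftrightarrow> bivector_field \<pi> \<and>
     (\<forall>p i j k. (\<Sum>l\<in>UNIV. \<pi> p $ i $ l * partial l (\<lambda>q. \<pi> q $ j $ k) p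
                        + \<pi> p $ j $ l * partial l (\<lambda>q. \<pi> q $ k $ i) p
                        + \<pi> p $ k $ l * partial l (\<lambda>q. \<pi> q $ i $ j) p) = 0)"

definition affine_poisson :: "bivector_field \<Rightarrow> bool" where
  "affine_poisson \<pi> \<longleftrightarrow> poisson \<pi> \<and> (\<exists>L C. linear L \<and> (\<forall>p. \<pi> p = L p + C))"

text \<open>\<open>\<rho>\<close> is the push-forward of \<open>\<pi>\<close> along the affine bijection \<open>p \<mapsto> A p + b\<close>.\<close>

definition affinely_isomorphic :: "bivector_field \<Rightarrow> bivector_field \<Rightarrow> bool" where
  "affinely_isomorphic \<pi> \<rho> \<longleftrightarrow>
     (\<exists>(A::real^3^3) b. invertible A \<and> (\<forall>p. \<rho> (A *v p + b) = A ** \<pi> p ** transpose A))"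

abbreviation ddx :: "real^3" where "ddx \<equiv> axis 1 1"
abbreviation ddy :: "real^3" where "ddy \<equiv> axis 2 1"
abbreviation ddz :: "real^3" where "ddz \<equiv> axis 3 1"

definition pi_f :: "(real^3 \<Rightarrow> real) \<Rightarrow> bivector_field" where
  "pi_f f p = partial 1 f p *\<^sub>R wedge ddy ddz + partial 2 f p *\<^sub>R wedge ddz ddx
            + partial 3 f p *\<^sub>R wedge ddx ddy"

text \<open>The Euler vector field has value \<open>p\<close> at the point \<open>p\<close>.\<close>

definition pi_kf :: "real^3 \<Rightarrow> (real^3 \<Rightarrow> real) \<Rightarrow> bivector_field" where
  "pi_kf k f p = (1/2) *\<^sub>R wedge p k + pi_f f p"

inductive normal_form :: "bivector_field \<Rightarrow> bool" where
  A1: "normal_form (\<lambda>p. wedge ddx ddy)"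
| A2: "normal_form (pi_f (\<lambda>q. (q$1)\<^sup>2 + (q$2)\<^sup>2 + (q$3)\<^sup>2))"
| A3: "normal_form (pi_f (\<lambda>q. (q$1)\<^sup>2 + (q$2)\<^sup>2 - (q$3)\<^sup>2))"
| A4: "normal_form (\<lambda>p. wedge ddx ddy + pi_f (\<lambda>q. (q$1)\<^sup>2 + (q$2)\<^sup>2) p)"
| A5: "normal_form (\<lambda>p. wedge ddx ddy + pi_f (\<lambda>q. (q$1)\<^sup>2 - (q$2)\<^sup>2) p)"
| A6: "normal_form (\<lambda>p. wedge ddx ddy + pi_f (\<lambda>q. (q$1)\<^sup>2) p)"
| B7: "normal_form (pi_kf ddz (\<lambda>q. 0))"
| B8: "a > 0 \<Longrightarrow> normal_form (pi_kf ddz (\<lambda>q. a * ((q$1)\<^sup>2 + (q$2)\<^sup>2)))"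
| B9_1: "a > 0 \<Longrightarrow> a \<noteq> 1/4 \<Longrightarrow> normal_form (pi_kf ddz (\<lambda>q. a * ((q$1)\<^sup>2 - (q$2)\<^sup>2)))"
| B9_2: "normal_form (\<lambda>p. wedge ddz ddx + pi_kf ddz (\<lambda>q. 1/4 * ((q$1)\<^sup>2 - (q$2)\<^sup>2)) p)"
| B10: "normal_form (pi_kf ddz (\<lambda>q. (q$1)\<^sup>2))"

text \<open>The linear parts of those normal forms that have a constant term.  They are themselves affine
  Poisson structures (the corresponding central extension splits), and none of them is isomorphic
  to a normal form above, so a list covering every affine Poisson structure has to contain them.\<close>

inductive split_form :: "bivector_field \<Rightarrow> bool" where
  S1: "split_form (\<lambda>p. 0)"
| S4: "split_form (pi_f (\<lambda>q. (q$1)\<^sup>2 + (q$2)\<^sup>2))"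
| S5: "split_form (pi_f (\<lambda>q. (q$1)\<^sup>2 - (q$2)\<^sup>2))"
| S6: "split_form (pi_f (\<lambda>q. (q$1)\<^sup>2))"
| S9: "split_form (pi_kf ddz (\<lambda>q. 1/4 * ((q$1)\<^sup>2 - (q$2)\<^sup>2)))"

end

theory Submission
  imports Defs
begin

text \<open>On three-space a bivector is the same as a vector \<open>w\<close>, and an affine bivector field becomes
  \<open>w p = M p + c\<close>.  The Jacobi identity reads \<open>w \<bullet> curl w = 0\<close>, where \<open>curl w\<close> is constant.  A linear
  change of coordinates with inverse \<open>B\<close> replaces \<open>M\<close> and \<open>c\<close> by \<open>B\<^sup>T M B / det B\<close> and
  \<open>B\<^sup>T c / det B\<close>, and a translation changes \<open>c\<close> by an element of the range of \<open>M\<close>.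
  If the curl vanishes, \<open>M\<close> is symmetric and can be diagonalised by congruence, the overall
  sign and scale being free because \<open>B\<close> may be multiplied by a scalar.  Otherwise the curl spans a
  line in both kernels of \<open>M\<close> and is orthogonal to \<open>c\<close>; taking it as third basis vector leaves a
  2 by 2 block whose skew part is normalised and whose symmetric part keeps its determinant as
  an invariant.  The block is singular exactly when that determinant is -1/4, which is where a
  constant term can survive.\<close>

section \<open>Bivectors as vectors, and the action of affine maps on them\<close>

definition skew :: "real^3 \<Rightarrow> real^3^3" where
  "skew w = w$1 *\<^sub>R wedge ddy ddz + w$2 *\<^sub>R wedge ddz ddx + w$3 *\<^sub>R wedge ddx ddy"

definition aff :: "real^3^3 \<Rightarrow> real^3 \<Rightarrow> bivector_field" where
  "aff M c p = skew (M *v p + c)"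

text \<open>The two alternatives of the goal are merged into one predicate that pulls back along
  isomorphisms, so a structure may be replaced by an isomorphic one at any stage.\<close>

definition classified :: "bivector_field \<Rightarrow> bool" where
  "classified \<pi> \<longleftrightarrow> (\<exists>\<rho>. (normal_form \<rho> \<or> split_form \<rho>) \<and> affinely_isomorphic \<pi> \<rho>)"

abbreviation mat3 :: "real \<Rightarrow> real \<Rightarrow> real \<Rightarrow> real \<Rightarrow> real \<Rightarrow> real \<Rightarrow> real \<Rightarrow> real \<Rightarrow> real \<Rightarrow> real^3^3" where
  "mat3 a b c d e f g h i \<equiv> vector [vector [a, b, c], vector [d, e, f], vector [g, h, i]]"

abbreviation diag3 :: "real \<Rightarrow> real \<Rightarrow> real \<Rightarrow> real^3^3" where
  "diag3 a b c \<equiv> mat3 a 0 0 0 b 0 0 0 c"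

lemmas entries = vec_eq_iff forall_3 sum_3 matrix_matrix_mult_def matrix_vector_mult_def
  transpose_def det_3

lemma skew_nth:
  "skew w $ 1 $ 1 = 0" "skew w $ 1 $ 2 = w$3" "skew w $ 1 $ 3 = - w$2"
  "skew w $ 2 $ 1 = - w$3" "skew w $ 2 $ 2 = 0" "skew w $ 2 $ 3 = w$1"
  "skew w $ 3 $ 1 = w$2" "skew w $ 3 $ 2 = - w$1" "skew w $ 3 $ 3 = 0"
  by (simp_all add: skew_def wedge_def axis_def)

text \<open>A congruence by \<open>B\<close> acts on the vector of a bivector through the cofactor
  matrix of \<open>B\<close>. Multiplying by \<open>transpose B\<close> turns this into a condition
  on \<open>z\<close> without inverses.\<close>

lemma skew_congruence:
  assumes "det B \<noteq> 0" and "transpose B *v z = det B *\<^sub>R w"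
  shows "B ** skew w ** transpose B = skew z"
proof -
  \<comment> \<open>\<open>y\<close> is the cofactor matrix of \<open>B\<close> applied to \<open>w\<close>.\<close>
  define y :: "real^3" where "y = vector [
    (B$2$2 * B$3$3 - B$2$3 * B$3$2) * w$1 + (B$2$3 * B$3$1 - B$2$1 * B$3$3) * w$2
      + (B$2$1 * B$3$2 - B$2$2 * B$3$1) * w$3,
    (B$3$2 * B$1$3 - B$3$3 * B$1$2) * w$1 + (B$3$3 * B$1$1 - B$3$1 * B$1$3) * w$2
      + (B$3$1 * B$1$2 - B$3$2 * B$1$1) * w$3,
    (B$1$2 * B$2$3 - B$1$3 * B$2$2) * w$1 + (B$1$3 * B$2$1 - B$1$1 * B$2$3) * w$2
      + (B$1$1 * B$2$2 - B$1$2 * B$2$1) * w$3]"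
  have "transpose B *v y = det B *\<^sub>R w"
    by (simp add: entries y_def) (simp add: algebra_simps)
  then have "transpose B *v y = transpose B *v z"
    using assms by simp
  moreover have "invertible (transpose B)"
    using assms(1) by (simp add: invertible_det_nz det_transpose)
  ultimately have "y = z"
    by (metis invertible_def matrix_vector_mul_assoc matrix_vector_mul_lid)
  moreover have "B ** skew w ** transpose B = skew y"
    by (simp add: entries skew_nth y_def) (simp add: algebra_simps)
  ultimately show ?thesis by simp
qed

lemma affinely_isomorphic_trans:
  assumes "affinely_isomorphic \<pi> \<rho>" "affinely_isomorphic \<rho> \<sigma>"
  shows "affinely_isomorphic \<pi> \<sigma>"
proof -
  obtain A b where A: "invertible A" "\<And>p. \<rho> (A *v p + b) = A ** \<pi> p ** transpose A"
    using assms(1) unfolding affinely_isomorphic_def by blast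
  obtain A' b' where A': "invertible A'" "\<And>p. \<sigma> (A' *v p + b') = A' ** \<rho> p ** transpose A'"
    using assms(2) unfolding affinely_isomorphic_def by blast
  have "\<sigma> ((A' ** A) *v p + (A' *v b + b')) = (A' ** A) ** \<pi> p ** transpose (A' ** A)" for p
    using A'(2)[of "A *v p + b"] A(2)[of p]
    by (simp add: matrix_vector_right_distrib matrix_vector_mul_assoc matrix_transpose_mul
        matrix_mul_assoc add.assoc)
  with A(1) A'(1) show ?thesis
    unfolding affinely_isomorphic_def using invertible_mult by blast
qed

lemma classified_iso:
  "affinely_isomorphic \<pi> \<rho> \<Longrightarrow> classified \<rho> \<Longrightarrow> classified \<pi>"
  unfolding classified_def using affinely_isomorphic_trans by blast

lemma affinely_isomorphic_refl: "affinely_isomorphic \<pi> \<pi>"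
  unfolding affinely_isomorphic_def
  by (rule exI[of _ "mat 1"], rule exI[of _ 0])
    (simp add: transpose_mat invertible_def exI[of _ "mat 1"])

lemma classified_translate:
  assumes "classified (aff M (c + M *v v))"
  shows "classified (aff M c)"
proof (rule classified_iso[OF _ assms])
  show "affinely_isomorphic (aff M c) (aff M (c + M *v v))"
    unfolding affinely_isomorphic_def
    by (rule exI[of _ "mat 1"], rule exI[of _ "- v"])
      (simp add: transpose_mat invertible_def exI[of _ "mat 1"] aff_def
        matrix_vector_mult_diff_distrib)
qed

text \<open>The isomorphism is the linear map inverse to \<open>B\<close>. With the conditions
  phrased through \<open>B\<close> itself, only matrix products have to be checked for an explicit
  \<open>B\<close>.\<close>

lemma classified_congruence:
  assumes "classified (aff M' c')" "det B \<noteq> 0"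
    and M': "transpose B ** M ** B = det B *\<^sub>R M'"
    and c': "transpose B *v c = det B *\<^sub>R c'"
  shows "classified (aff M c)"
proof (rule classified_iso[OF _ assms(1)])
  obtain A where A: "A ** B = mat 1" "B ** A = mat 1"
    using assms(2) by (metis invertible_def invertible_det_nz)
  have "aff M' c' (A *v p + 0) = A ** aff M c p ** transpose A" for p
  proof -
    have "B ** skew (M' *v (A *v p) + c') ** transpose B = skew (M *v p + c)"
    proof (rule skew_congruence[OF assms(2)])
      have "(transpose B ** M ** B) *v (A *v p) = transpose B *v (M *v ((B ** A) *v p))"
        by (simp only: matrix_vector_mul_assoc matrix_mul_assoc)
      then have "transpose B *v (M *v p) = (transpose B ** M ** B) *v (A *v p)"
        by (simp only: A(2) matrix_vector_mul_lid)
      then show "transpose B *v (M *v p + c) = det B *\<^sub>R (M' *v (A *v p) + c')"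
        unfolding matrix_vector_right_distrib c' M' scaleR_right_distrib
        by (simp only: scaleR_matrix_vector_assoc)
    qed
    then have "A ** skew (M *v p + c) ** transpose A
        = A ** (B ** skew (M' *v (A *v p) + c') ** transpose B) ** transpose A"
      by simp
    also have "\<dots> = (A ** B) ** skew (M' *v (A *v p) + c') ** transpose (A ** B)"
      by (simp only: matrix_transpose_mul matrix_mul_assoc)
    finally show ?thesis
      by (simp add: A(1) aff_def transpose_mat)
  qed
  moreover have "invertible A"
    using A by (auto simp: invertible_def)
  ultimately show "affinely_isomorphic (aff M c) (aff M' c')"
    unfolding affinely_isomorphic_def by blast
qed

text \<open>Once every constant over \<open>M'\<close> is settled, the constant need not be tracked.
  Since \<open>s\<close> may be negative, \<open>M\<close> then matters only up to scale and
  sign.\<close>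

lemma all_classified_congruence:
  assumes "\<And>c. classified (aff M' c)" "s *\<^sub>R (transpose B ** M ** B) = M'" "s \<noteq> 0" "det B \<noteq> 0"
  shows "classified (aff M c)"
proof -
  \<comment> \<open>Replacing \<open>B\<close> by \<open>t B\<close> divides \<open>B\<^sup>T M B / det B\<close> by \<open>t\<close>.\<close>
  define t where "t = 1 / (s * det B)"
  have t: "t \<noteq> 0" using assms by (simp add: t_def)
  have det: "det (t *\<^sub>R B) = t^3 * det B"
    by (simp add: det_3 algebra_simps power3_eq_cube)
  show ?thesis
  proof (rule classified_congruence[where B = "t *\<^sub>R B"])
    show "det (t *\<^sub>R B) \<noteq> 0" using det t assms by simp
    have "t^3 * det B * s = t^2"
      using assms by (simp add: t_def power3_eq_cube power2_eq_square)
    then show "transpose (t *\<^sub>R B) ** M ** (t *\<^sub>R B)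
        = det (t *\<^sub>R B) *\<^sub>R M'"
      unfolding det assms(2)[symmetric]
      by (simp add: transpose_scalar scalar_matrix_assoc matrix_scalar_ac power2_eq_square)
    show "transpose (t *\<^sub>R B) *v c
        = det (t *\<^sub>R B) *\<^sub>R ((1 / det (t *\<^sub>R B)) *\<^sub>R (transpose (t *\<^sub>R B) *v c))"
      using det t assms by simp
  qed (rule assms)
qed

text \<open>The vectors \<open>(p, r)\<close> and \<open>(q, s)\<close> are orthogonal for the
  quadratic form with coefficients \<open>a\<close>, \<open>2 * b\<close>, \<open>d\<close>.
  Determinant one is wanted where a skew part must stay fixed.\<close>

lemma diagonalise2:
  fixes a b d :: real
  obtains p q r s :: real
  where "p * s - q * r = 1" "a * p * q + b * (p * s + q * r) + d * r * s = 0"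
proof -
  consider "a \<noteq> 0" | "d \<noteq> 0" | "a = 0" "d = 0" by blast
  then show thesis
  proof cases
    case 1
    then show thesis by (intro that[of 1 1 "- b / a" 0]) auto
  next
    case 2
    then show thesis by (intro that[of 1 1 0 "- b / d"]) auto
  next
    case 3
    \<comment> \<open>For a multiple of \<open>x * y\<close> the two diagonal directions are
      orthogonal. The instantiation order is \<open>p\<close>, \<open>s\<close>, \<open>q\<close>,
      \<open>r\<close>.\<close>
    then show thesis by (intro that[of 1 "1/2" "-1/2" 1]) auto
  qed
qed

section \<open>Partial derivatives, and the listed forms in matrix terms\<close>

lemma has_derivative_partial:
  assumes "(f has_derivative f') (at p)"
  shows "partial i f p = f' (axis i 1)"
  using assms unfolding partial_def by (metis frechet_derivative_at)

lemma partial_quadratic: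
  fixes a b d :: real
  defines "f \<equiv> \<lambda>q::real^3. a * (q$1)\<^sup>2 + b * (q$2)\<^sup>2 + d * (q$3)\<^sup>2"
  shows "partial 1 f p = 2 * a * p$1" "partial 2 f p = 2 * b * p$2" "partial 3 f p = 2 * d * p$3"
proof -
  have "(f has_derivative (\<lambda>h. 2 * a * p$1 * h$1 + 2 * b * p$2 * h$2 + 2 * d * p$3 * h$3)) (at p)"
    unfolding f_def
    by (auto intro!: derivative_eq_intros bounded_linear_imp_has_derivative[OF bounded_linear_vec_nth]
        simp: algebra_simps)
  from has_derivative_partial[OF this]
  show "partial 1 f p = 2 * a * p$1" "partial 2 f p = 2 * b * p$2" "partial 3 f p = 2 * d * p$3"
    by (simp_all add: axis_def)
qed

text \<open>\<open>pi_f f\<close> is \<open>skew\<close> of the gradient of \<open>f\<close>, so the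
  matrix is the Hessian; hence the factors 2.\<close>

lemma pi_f_quadratic:
  "pi_f (\<lambda>q. a * (q$1)\<^sup>2 + b * (q$2)\<^sup>2 + d * (q$3)\<^sup>2) = aff (diag3 (2*a) (2*b) (2*d)) 0"
  by (rule ext) (simp add: pi_f_def aff_def skew_def partial_quadratic entries)

text \<open>The entries \<open>1/2\<close> and \<open>-1/2\<close> come from the modular vector
  \<open>ddz\<close>; the upper block has determinant \<open>a * b + 1/4\<close>.\<close>

abbreviation modular3 :: "real \<Rightarrow> real \<Rightarrow> real^3^3" where
  "modular3 a b \<equiv> mat3 a (1/2) 0 (-1/2) b 0 0 0 0"

lemma pi_kf_quadratic:
  "pi_kf ddz (\<lambda>q. a * (q$1)\<^sup>2 + b * (q$2)\<^sup>2) = aff (modular3 (2*a) (2*b)) 0"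
proof (rule ext)
  fix p :: "real^3"
  let ?f = "\<lambda>q::real^3. a * (q$1)\<^sup>2 + b * (q$2)\<^sup>2"
  have "pi_f ?f p = aff (diag3 (2*a) (2*b) 0) 0 p"
    using pi_f_quadratic[of a b 0] by simp
  moreover have "(1/2) *\<^sub>R wedge p ddz = skew (vector [p$2 / 2, - p$1 / 2, 0])"
    by (simp add: vec_eq_iff forall_3 skew_nth) (simp add: wedge_def axis_def)
  moreover have "skew u + skew v = skew (u + v)" for u v
    by (simp add: skew_def algebra_simps)
  moreover have "vector [p$2 / 2, - p$1 / 2, 0] + diag3 (2*a) (2*b) 0 *v p = modular3 (2*a) (2*b) *v p"
    by (simp add: entries)
  ultimately show "pi_kf ddz ?f p = aff (modular3 (2*a) (2*b)) 0 p"
    by (simp add: pi_kf_def aff_def)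
qed

lemma aff_add_const: "skew v + aff M c p = aff M (c + v) p"
  by (simp add: aff_def skew_def algebra_simps)

lemma wedge_eq_skew: "wedge ddx ddy = skew ddz" "wedge ddz ddx = skew ddy"
  by (simp_all add: skew_def axis_def)

lemma normal_form_classified: "normal_form \<rho> \<Longrightarrow> classified \<rho>"
  and split_form_classified: "split_form \<rho> \<Longrightarrow> classified \<rho>"
  unfolding classified_def using affinely_isomorphic_refl by blast+

lemma classified_definite: "classified (aff (diag3 2 2 2) 0)"
  using normal_form_classified[OF A2] pi_f_quadratic[of 1 1 1] by simp

lemma classified_lorentzian: "classified (aff (diag3 2 2 (-2)) 0)"
  using normal_form_classified[OF A3] pi_f_quadratic[of 1 1 "-1"] by simp

lemma classified_rank2_forms:
  "classified (aff (diag3 2 2 0) 0)" "classified (aff (diag3 2 2 0) ddz)"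
  "classified (aff (diag3 2 (-2) 0) 0)" "classified (aff (diag3 2 (-2) 0) ddz)"
  using split_form_classified[OF S4] normal_form_classified[OF A4]
    split_form_classified[OF S5] normal_form_classified[OF A5]
    pi_f_quadratic[of 1 1 0] pi_f_quadratic[of 1 "-1" 0]
  by (simp_all add: wedge_eq_skew aff_add_const)

lemma classified_rank1_forms:
  "classified (aff (diag3 2 0 0) 0)" "classified (aff (diag3 2 0 0) ddz)"
  using split_form_classified[OF S6] normal_form_classified[OF A6] pi_f_quadratic[of 1 0 0]
  by (simp_all add: wedge_eq_skew aff_add_const)

lemma classified_rank0_forms:
  "classified (aff 0 0)" "classified (aff 0 ddz)"
proof -
  have "aff 0 0 = (\<lambda>p. 0)" "aff 0 ddz = (\<lambda>p. wedge ddx ddy)"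
    by (rule ext; simp add: aff_def skew_def axis_def)+
  then show "classified (aff 0 0)" "classified (aff 0 ddz)"
    using split_form_classified[OF S1] normal_form_classified[OF A1] by simp_all
qed

section \<open>Symmetric linear part\<close>

text \<open>An invertible linear part has full range, so a translation removes the constant.\<close>

lemma classified_diag_rank3:
  assumes "a \<noteq> 0" "b \<noteq> 0" "d \<noteq> 0" "classified (aff (diag3 a b d) 0)"
  shows "classified (aff (diag3 a b d) c)"
proof (rule classified_translate)
  have "c + diag3 a b d *v vector [- c$1 / a, - c$2 / b, - c$3 / d] = 0"
    using assms(1-3) by (simp add: entries)
  then show "classified (aff (diag3 a b d) (c + diag3 a b d *v vector [- c$1 / a, - c$2 / b, - c$3 / d]))"
    using assms(4) by simp
qed

lemma classified_diag_rank2: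
  assumes "s \<noteq> 0" "classified (aff (diag3 2 s 0) 0)" "classified (aff (diag3 2 s 0) ddz)"
  shows "classified (aff (diag3 2 s 0) c)"
proof -
  have *: "classified (aff (diag3 2 s 0) (vector [0, 0, g]))" for g
  proof (cases "g = 0")
    case True
    then have "vector [0, 0, g] = (0::real^3)" by (simp add: entries)
    then show ?thesis using assms by simp
  next
    case False
    \<comment> \<open>This diagonal matrix has determinant \<open>\<bar>g\<bar>\<close> and scales
      the linear part by it. The last sign turns \<open>g\<close> into \<open>\<bar>g\<bar>\<close>,
      and the middle one keeps the determinant positive.\<close>
    then show ?thesis
      by (intro classified_congruence[OF assms(3), of "diag3 (sqrt \<bar>g\<bar>) (sqrt \<bar>g\<bar> * sgn g) (sgn g)"])
        (auto simp: entries axis_def sgn_if)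
  qed
  have "c + diag3 2 s 0 *v vector [- c$1 / 2, - c$2 / s, 0] = vector [0, 0, c$3]"
    using assms(1) by (simp add: entries)
  with *[of "c$3"] show ?thesis
    by (metis classified_translate)
qed

lemma classified_diag_rank1: "classified (aff (diag3 2 0 0) c)"
proof -
  have *: "classified (aff (diag3 2 0 0) (vector [0, g, h]))" for g h
  proof (cases "g = 0 \<and> h = 0")
    case True
    then have "vector [0, g, h] = (0::real^3)" by (simp add: entries)
    then show ?thesis using classified_rank1_forms by simp
  next
    case False
    let ?N = "g * g + h * h"
    \<comment> \<open>\<open>?B\<close> leaves the first coordinate alone, the only one that
      \<open>diag3 2 0 0\<close> sees. Its second and third columns pair with
      \<open>(0, g, h)\<close> to 0 and 1.\<close>
    let ?B = "mat3 1 0 0 0 h (g / ?N) 0 (- g) (h / ?N)"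
    have "?N \<noteq> 0" using False by (auto simp: sum_squares_eq_zero_iff)
    then have one: "g * g / ?N + h * h / ?N = 1"
      by (simp flip: add_divide_distrib)
    then have det: "det ?B = 1" by (simp add: det_3)
    then have "det ?B \<noteq> 0" by simp
    moreover have "transpose ?B ** diag3 2 0 0 ** ?B = det ?B *\<^sub>R diag3 2 0 0"
      unfolding det by (simp add: entries)
    moreover have "transpose ?B *v vector [0, g, h] = det ?B *\<^sub>R ddz"
      unfolding det using one by (simp add: entries axis_def)
    ultimately show ?thesis
      by (rule classified_congruence[OF classified_rank1_forms(2)])
  qed
  have "c + diag3 2 0 0 *v vector [- c$1 / 2, 0, 0] = vector [0, c$2, c$3]"
    by (simp add: entries)
  with *[of "c$2" "c$3"] show ?thesis
    by (metis classified_translate)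
qed

text \<open>In each witness the first two columns are orthogonal to \<open>c\<close>, and the third
  pairs with \<open>c\<close> to the determinant, so \<open>c\<close> is carried to
  \<open>ddz\<close>.\<close>

lemma classified_const: "classified (aff 0 c)"
proof -
  consider "c = 0" | "c$3 \<noteq> 0" | "c$3 = 0" "c$2 \<noteq> 0" | "c$3 = 0" "c$2 = 0" "c$1 \<noteq> 0"
    by (auto simp: vec_eq_iff forall_3)
  then show ?thesis
  proof cases
    case 1
    then show ?thesis using classified_rank0_forms by simp
  next
    case 2
    then show ?thesis
      by (intro classified_congruence[OF classified_rank0_forms(2), of "mat3 (c$3) 0 0 0 1 0 (- c$1) (- c$2 / c$3) 1"])
        (simp_all add: entries axis_def)
  next
    case 3
    then show ?thesis
      by (intro classified_congruence[OF classified_rank0_forms(2), of "mat3 (c$2) 0 0 (- c$1) 0 1 0 (-1) 0"])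
        (simp_all add: entries axis_def)
  next
    case 4
    then show ?thesis
      by (intro classified_congruence[OF classified_rank0_forms(2), of "mat3 0 0 1 (c$1) 0 0 0 1 0"])
        (simp_all add: entries axis_def)
  qed
qed

text \<open>As in Sylvester's law of inertia, rescaling axes leaves only signs; axis swaps and a
  global sign change then reduce these to six patterns.\<close>

lemma classified_diag: "classified (aff (diag3 a b d) c)"
proof -
  define P where "P a b d \<longleftrightarrow> (\<forall>c. classified (aff (diag3 a b d) c))" for a b d
  have scale: "P a b d" if "P (p\<^sup>2 * a) (q\<^sup>2 * b) (r\<^sup>2 * d)" "p \<noteq> 0" "q \<noteq> 0" "r \<noteq> 0" for a b d p q r
  proof -
    have "1 *\<^sub>R (transpose (diag3 p q r) ** diag3 a b d ** diag3 p q r) = diag3 (p\<^sup>2 * a) (q\<^sup>2 * b) (r\<^sup>2 * d)"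
      by (simp add: entries power2_eq_square)
    moreover have "1 \<noteq> (0::real)" "det (diag3 p q r) \<noteq> 0"
      using that by (simp_all add: det_3)
    ultimately have "classified (aff (diag3 a b d) c)" for c
      by (rule all_classified_congruence[OF that(1)[unfolded P_def, rule_format]])
    then show ?thesis by (simp add: P_def)
  qed
  have neg: "P a b d" if "P (- a) (- b) (- d)" for a b d
  proof -
    have "(-1) *\<^sub>R (transpose (diag3 1 1 1) ** diag3 a b d ** diag3 1 1 1) = diag3 (- a) (- b) (- d)"
      by (simp add: entries)
    moreover have "(-1) \<noteq> (0::real)" "det (diag3 1 1 1) \<noteq> 0"
      using that by (simp_all add: det_3)
    ultimately have "classified (aff (diag3 a b d) c)" for c
      by (rule all_classified_congruence[OF that(1)[unfolded P_def, rule_format]])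
    then show ?thesis by (simp add: P_def)
  qed
  have swap12: "P a b d" if "P b a d" for a b d
  proof -
    have "1 *\<^sub>R (transpose (mat3 0 1 0 1 0 0 0 0 1) ** diag3 a b d ** mat3 0 1 0 1 0 0 0 0 1) = diag3 b a d"
      by (simp add: entries)
    moreover have "1 \<noteq> (0::real)" "det (mat3 0 1 0 1 0 0 0 0 1) \<noteq> 0"
      using that by (simp_all add: det_3)
    ultimately have "classified (aff (diag3 a b d) c)" for c
      by (rule all_classified_congruence[OF that(1)[unfolded P_def, rule_format]])
    then show ?thesis by (simp add: P_def)
  qed
  have swap23: "P a b d" if "P a d b" for a b d
  proof -
    have "1 *\<^sub>R (transpose (mat3 1 0 0 0 0 1 0 1 0) ** diag3 a b d ** mat3 1 0 0 0 0 1 0 1 0) = diag3 a d b"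
      by (simp add: entries)
    moreover have "1 \<noteq> (0::real)" "det (mat3 1 0 0 0 0 1 0 1 0) \<noteq> 0"
      using that by (simp_all add: det_3)
    ultimately have "classified (aff (diag3 a b d) c)" for c
      by (rule all_classified_congruence[OF that(1)[unfolded P_def, rule_format]])
    then show ?thesis by (simp add: P_def)
  qed
  have "diag3 0 0 0 = (0 :: real^3^3)" by (simp add: entries)
  then have base: "P 2 2 2" "P 2 2 (-2)" "P 2 2 0" "P 2 (-2) 0" "P 2 0 0" "P 0 0 0"
    unfolding P_def
    using classified_diag_rank3[OF _ _ _ classified_definite]
      classified_diag_rank3[OF _ _ _ classified_lorentzian]
      classified_diag_rank2[OF _ classified_rank2_forms(1,2)]
      classified_diag_rank2[OF _ classified_rank2_forms(3,4)]
      classified_diag_rank1 classified_const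
    by simp_all
  have signs: "P a b d" if "a \<in> {2, -2, 0}" "b \<in> {2, -2, 0}" "d \<in> {2, -2, 0}" for a b d
  proof -
    have neg': "P (-2) (-2) (-2)" "P (-2) (-2) 2" "P (-2) (-2) 0" "P (-2) 0 0"
      by (rule neg, simp add: base)+
    moreover have "P b a d = P a b d" "P a d b = P a b d" for a b d
      using swap12 swap23 by blast+
    ultimately show ?thesis using base that by auto
  qed
  \<comment> \<open>A square factor normalises the size and keeps the sign; for \<open>x = 0\<close>
    the choice 1 serves.\<close>
  have "\<exists>p::real. p \<noteq> 0 \<and> p\<^sup>2 * x \<in> {2, -2, 0}" for x :: real
  proof (cases "x = 0")
    case False
    then show ?thesis
      by (intro exI[of _ "sqrt (2 / \<bar>x\<bar>)"]) (auto simp: abs_if)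
  qed (auto intro: exI[of _ 1])
  then obtain p q r where pqr: "p \<noteq> 0" "q \<noteq> 0" "r \<noteq> 0"
    "p\<^sup>2 * a \<in> {2, -2, 0}" "q\<^sup>2 * b \<in> {2, -2, 0}" "r\<^sup>2 * d \<in> {2, -2, 0}"
    by metis
  have "P a b d"
    by (rule scale[OF signs[OF pqr(4-6)] pqr(1-3)])
  then show ?thesis by (simp add: P_def)
qed

text \<open>The first axis is already split off, so diagonalising the lower block suffices.\<close>

lemma classified_symmetric_block: "classified (aff (mat3 a 0 0 0 b e 0 e d) c)"
proof -
  obtain p q r s :: real where pqrs: "p * s - q * r = 1" "b * p * q + e * (p * s + q * r) + d * r * s = 0"
    by (rule diagonalise2)
  let ?B = "mat3 1 0 0 0 p q 0 r s"
  let ?a = "b * p * p + 2 * e * p * r + d * r * r" and ?d = "b * q * q + 2 * e * q * s + d * s * s"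
  have "1 *\<^sub>R (transpose ?B ** mat3 a 0 0 0 b e 0 e d ** ?B) = diag3 a ?a ?d"
    using pqrs(2) by (simp add: entries algebra_simps)
  moreover have "det ?B \<noteq> 0" using pqrs(1) by (simp add: det_3)
  ultimately show ?thesis
    using all_classified_congruence[OF classified_diag] by (metis one_neq_zero)
qed

text \<open>Completing the square with the nonzero corner entry splits off the first axis and leaves
  the Schur complement.\<close>

lemma classified_symmetric_pivot:
  assumes "a \<noteq> 0"
  shows "classified (aff (mat3 a b d b e f d f g) c)"
proof -
  let ?B = "mat3 1 (- b / a) (- d / a) 0 1 0 0 0 1"
  let ?h = "f - b * d / a"
  have "1 *\<^sub>R (transpose ?B ** mat3 a b d b e f d f g ** ?B)
      = mat3 a 0 0 0 (e - b * b / a) ?h 0 ?h (g - d * d / a)"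
    using assms by (simp add: entries)
  moreover have "det ?B \<noteq> 0" by (simp add: det_3)
  ultimately show ?thesis
    using all_classified_congruence[OF classified_symmetric_block] by (metis one_neq_zero)
qed

lemma symmetric_nth:
  assumes "transpose M = M"
  shows "M $ i $ j = M $ j $ i"
proof -
  have "transpose M $ i $ j = M $ j $ i" by (simp add: transpose_def)
  then show ?thesis by (simp add: assms)
qed

lemma classified_symmetric:
  assumes "transpose M = M"
  shows "classified (aff M c)"
proof (cases "M = 0")
  case True
  then show ?thesis by (simp add: classified_const)
next
  case False
  have sym: "M$2$1 = M$1$2" "M$3$1 = M$1$3" "M$3$2 = M$2$3"
    by (rule symmetric_nth[OF assms])+
  \<comment> \<open>The corner entry is the value of the quadratic form on the first column of
    \<open>B\<close>, so it remains to find a vector with nonzero value.\<close>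
  have *: "classified (aff M c)"
    if "det B \<noteq> 0" "(transpose B ** M ** B)$1$1 \<noteq> 0" for B :: "real^3^3"
  proof -
    let ?N = "transpose B ** M ** B"
    have "transpose ?N = ?N"
      by (simp only: matrix_transpose_mul transpose_transpose assms matrix_mul_assoc)
    then have "?N$2$1 = ?N$1$2" "?N$3$1 = ?N$1$3" "?N$3$2 = ?N$2$3"
      by (rule symmetric_nth)+
    then have "1 *\<^sub>R ?N = mat3 (?N$1$1) (?N$1$2) (?N$1$3) (?N$1$2) (?N$2$2) (?N$2$3)
        (?N$1$3) (?N$2$3) (?N$3$3)"
      by (simp add: vec_eq_iff forall_3)
    then show ?thesis
      using that all_classified_congruence[OF classified_symmetric_pivot] by (metis one_neq_zero)
  qed
  \<comment> \<open>A nonzero diagonal entry gives a basis vector. If two diagonal entries vanish,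
    the sum of the two basis vectors has twice the off-diagonal entry as its value.\<close>
  consider "M$1$1 \<noteq> 0" | "M$2$2 \<noteq> 0" | "M$3$3 \<noteq> 0"
    | "M$1$1 = 0" "M$2$2 = 0" "M$1$2 \<noteq> 0" | "M$1$1 = 0" "M$3$3 = 0" "M$1$3 \<noteq> 0"
    | "M$2$2 = 0" "M$3$3 = 0" "M$2$3 \<noteq> 0"
    using False sym by (auto simp: vec_eq_iff forall_3)
  then show ?thesis
  proof cases
    case 1
    then show ?thesis by (intro *[of "diag3 1 1 1"]) (simp_all add: entries)
  next
    case 2
    then show ?thesis by (intro *[of "mat3 0 1 0 1 0 0 0 0 1"]) (simp_all add: entries)
  next
    case 3
    then show ?thesis by (intro *[of "mat3 0 0 1 0 1 0 1 0 0"]) (simp_all add: entries)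
  next
    case 4
    then show ?thesis by (intro *[of "mat3 1 0 0 1 1 0 0 0 1"]) (simp_all add: entries sym)
  next
    case 5
    then show ?thesis by (intro *[of "mat3 1 0 0 0 1 0 1 0 1"]) (simp_all add: entries sym)
  next
    case 6
    then show ?thesis by (intro *[of "mat3 0 1 0 1 0 0 1 0 1"]) (simp_all add: entries sym)
  qed
qed

section \<open>Nonsymmetric linear part: the 2 by 2 block\<close>

lemma classified_modular_regular_forms:
  assumes "a > 0"
  shows "classified (aff (modular3 (2*a) (2*a)) 0)"
    and "a \<noteq> 1/4 \<Longrightarrow> classified (aff (modular3 (2*a) (-2*a)) 0)"
    and "classified (aff (modular3 2 0) 0)"
    and "classified (aff (modular3 0 0) 0)"
  using normal_form_classified[OF B8[OF assms]] normal_form_classified[OF B9_1[OF assms]]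
    normal_form_classified[OF B10] normal_form_classified[OF B7]
    pi_kf_quadratic[of a a] pi_kf_quadratic[of a "-a"] pi_kf_quadratic[of 1 0]
    pi_kf_quadratic[of 0 0]
  by (simp_all add: algebra_simps)

lemma classified_modular_critical_forms:
  "classified (aff (modular3 (1/2) (-1/2)) 0)"
  "classified (aff (modular3 (1/2) (-1/2)) ddy)"
  using split_form_classified[OF S9] normal_form_classified[OF B9_2] pi_kf_quadratic[of "1/4" "-1/4"]
  by (simp_all add: wedge_eq_skew aff_add_const algebra_simps)

lemma classified_modular_regular:
  assumes "a * d \<noteq> - 1/4" "classified (aff (modular3 a d) 0)"
  shows "classified (aff (modular3 a d) (vector [c1, c2, 0]))"
proof -
  define D where "D = a * d + 1/4"
  \<comment> \<open>Cramer's rule for the translation that cancels the constant; \<open>D\<close> is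
    the determinant of the block.\<close>
  define x y where "x = (c2 / 2 - d * c1) / D" and "y = (- c1 / 2 - a * c2) / D"
  have "D \<noteq> 0" using assms(1) by (auto simp: D_def)
  then have "D * x = c2 / 2 - d * c1" "D * y = - c1 / 2 - a * c2"
    by (simp_all add: x_def y_def)
  then have "D * (c1 + (a * x + y / 2)) = 0" "D * (c2 + (d * y - x / 2)) = 0"
    unfolding D_def by algebra+
  with \<open>D \<noteq> 0\<close> have "c1 + (a * x + y / 2) = 0" "c2 + (d * y - x / 2) = 0"
    by simp_all
  then have "vector [c1, c2, 0] + modular3 a d *v vector [x, y, 0] = 0"
    by (simp add: entries)
  then show ?thesis
    using assms(2) by (metis classified_translate)
qed

text \<open>The block is singular with range spanned by \<open>(1, -1)\<close>, so translations
  leave only \<open>c1 + c2\<close>.\<close>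

lemma classified_modular_critical:
  "classified (aff (modular3 (1/2) (-1/2)) (vector [c1, c2, 0]))"
proof -
  have *: "classified (aff (modular3 (1/2) (-1/2)) (vector [0, g, 0]))" for g
  proof (cases "g = 0")
    case True
    then have "vector [0, g, 0] = (0::real^3)" by (simp add: entries)
    then show ?thesis using classified_modular_critical_forms by simp
  next
    case False
    \<comment> \<open>\<open>diag3 g g 1\<close> scales the block by its determinant
      \<open>g * g\<close> and sends the constant \<open>g\<close> to the same value.\<close>
    then show ?thesis
      by (intro classified_congruence[OF classified_modular_critical_forms(2), of "diag3 g g 1"])
        (simp_all add: entries axis_def)
  qed
  have "vector [c1, c2, 0] + modular3 (1/2) (-1/2) *v vector [- 2 * c1, 0, 0] = vector [0, c1 + c2, 0]"
    by (simp add: entries)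
  with *[of "c1 + c2"] show ?thesis
    by (metis classified_translate)
qed

lemma classified_modular: "classified (aff (modular3 a d) (vector [c1, c2, 0]))"
proof -
  define Q where "Q a d \<longleftrightarrow> (\<forall>c1 c2. classified (aff (modular3 a d) (vector [c1, c2, 0])))" for a d
  \<comment> \<open>Stretching the first axis preserves the invariant \<open>a * d\<close>.\<close>
  have scale: "Q a d" if "Q (t * a) (d / t)" "t \<noteq> 0" for a d t
  proof -
    have "classified (aff (modular3 a d) (vector [c1, c2, 0]))" for c1 c2
      by (rule classified_congruence[OF that(1)[unfolded Q_def, rule_format, of c1 "c2 / t"], of "diag3 t 1 1"])
        (use that(2) in \<open>simp_all add: entries\<close>)
    then show ?thesis by (simp add: Q_def)
  qed
  \<comment> \<open>Exchanging two axes has determinant -1: the skew part survives, and the diagonal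
    entries change places and sign.\<close>
  have swap: "Q a d" if "Q (- d) (- a)" for a d
  proof -
    have "classified (aff (modular3 a d) (vector [c1, c2, 0]))" for c1 c2
      by (rule classified_congruence[OF that(1)[unfolded Q_def, rule_format, of "- c2" "- c1"],
            of "mat3 0 1 0 1 0 0 0 0 1"]) (simp_all add: entries)
    then show ?thesis by (simp add: Q_def)
  qed
  have definite: "Q x x" if "x > 0" for x
  proof -
    have "x * x > 0" using that by simp
    then have "x * x \<noteq> - 1/4" by linarith
    moreover have "classified (aff (modular3 x x) 0)"
      using classified_modular_regular_forms(1)[of "x/2"] that by simp
    ultimately show ?thesis
      unfolding Q_def by (intro allI classified_modular_regular)
  qed
  have indefinite: "Q x (- x)" if "x > 0" for x
  \<comment> \<open>For positive \<open>x\<close> the block is singular exactly at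
    \<open>x = 1/2\<close>.\<close>
  proof (cases "x = 1/2")
    case True
    show ?thesis using classified_modular_critical unfolding Q_def True by simp
  next
    case False
    have "(x - 1/2) * (x + 1/2) \<noteq> 0" using False that by simp
    then have "x * (- x) \<noteq> - 1/4" by (simp add: algebra_simps)
    moreover have "classified (aff (modular3 x (- x)) 0)"
      using classified_modular_regular_forms(2)[of "x/2"] that False by simp
    ultimately show ?thesis
      unfolding Q_def by (intro allI classified_modular_regular)
  qed
  have degenerate: "Q 2 0" "Q 0 0"
    unfolding Q_def
    by (intro allI classified_modular_regular classified_modular_regular_forms(3,4)[of 1]; simp)+
  have rank1: "Q x 0" if "x \<noteq> 0" for x
    using scale[of "2 / x" x 0] degenerate that by simp
  have "Q a d"
  proof -
    consider "a = 0" "d = 0" | "a \<noteq> 0" "d = 0" | "a = 0" "d \<noteq> 0" | "a \<noteq> 0" "d \<noteq> 0" by blast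
    then show ?thesis
    proof cases
      case 4
      \<comment> \<open>The size of \<open>t\<close> makes \<open>t * a\<close> and
        \<open>d / t\<close> equal up to sign, and its sign makes \<open>t * a\<close>
        positive.\<close>
      define t where "t = sgn a * sqrt \<bar>d / a\<bar>"
      have t: "t \<noteq> 0" "t * t = \<bar>d / a\<bar>"
        using 4 by (auto simp: t_def sgn_if)
      have pos: "t * a > 0"
        using 4 by (auto simp: t_def sgn_if zero_less_mult_iff mult_less_0_iff)
      have "d / t = t * a \<or> d / t = - (t * a)"
      proof -
        have "t * a * t = \<bar>d\<bar> * sgn a"
          using t 4 by (simp add: mult.assoc mult.left_commute[of t a] sgn_if abs_if divide_simps)
        then have "d = t * a * t \<or> d = - (t * a * t)"
          using 4 by (auto simp: abs_if sgn_if)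
        then show ?thesis using t(1) by (auto simp: divide_simps)
      qed
      then have "Q (t * a) (d / t)"
        using definite[OF pos] indefinite[OF pos] by auto
      then show ?thesis using t(1) by (rule scale)
    next
      case 3
      then show ?thesis using swap[of d 0] rank1[of "- d"] by simp
    qed (use degenerate rank1 in simp_all)
  qed
  then show ?thesis by (simp add: Q_def)
qed

text \<open>A congruence of determinant one fixes the skew part, so the symmetric part can be
  diagonalised on its own.\<close>

lemma classified_block:
  "classified (aff (mat3 a (b + 1/2) 0 (b - 1/2) d 0 0 0 0) (vector [c1, c2, 0]))"
proof -
  obtain p q r s :: real where pqrs: "p * s - q * r = 1" "a * p * q + b * (p * s + q * r) + d * r * s = 0"
    by (rule diagonalise2)
  let ?B = "mat3 p q 0 r s 0 0 0 1"
  let ?a = "a * p * p + 2 * b * p * r + d * r * r" and ?d = "a * q * q + 2 * b * q * s + d * s * s"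
  have det: "det ?B = 1" using pqrs(1) by (simp add: det_3)
  have "p * s = 1 + q * r" using pqrs(1) by simp
  then have "transpose ?B ** mat3 a (b + 1/2) 0 (b - 1/2) d 0 0 0 0 ** ?B = det ?B *\<^sub>R modular3 ?a ?d"
    unfolding det using pqrs(2) by (simp add: entries algebra_simps add_divide_distrib)
  moreover have "transpose ?B *v vector [c1, c2, 0] = det ?B *\<^sub>R vector [p * c1 + r * c2, q * c1 + s * c2, 0]"
    unfolding det by (simp add: entries)
  moreover have "det ?B \<noteq> 0" using det by simp
  ultimately show ?thesis
    using classified_congruence[OF classified_modular] by blast
qed

section \<open>Reduction to the block along the curl\<close>

text \<open>The curl of the vector field \<open>M *v p + c\<close>. For \<open>modular3\<close> it
  is \<open>- ddz\<close>, whence the minus signs in the third basis vector below.\<close>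

definition curl :: "real^3^3 \<Rightarrow> real^3" where
  "curl M = vector [M$3$2 - M$2$3, M$1$3 - M$3$1, M$2$1 - M$1$2]"

lemma curl_nth:
  "curl M $ 1 = M$3$2 - M$2$3" "curl M $ 2 = M$1$3 - M$3$1" "curl M $ 3 = M$2$1 - M$1$2"
  by (simp_all add: curl_def)

text \<open>The curl annihilates \<open>M\<close> from the left by assumption. As
  \<open>M - transpose M\<close> is the cross product with the curl, it annihilates \<open>M\<close>
  from the right as well.\<close>

lemma classified_curl_basis:
  fixes M :: "real^3^3" and u v :: "real^3"
  defines "B \<equiv> mat3 (u$1) (v$1) (- curl M$1) (u$2) (v$2) (- curl M$2) (u$3) (v$3) (- curl M$3)"
  assumes det: "det B \<noteq> 0"
    and curl: "\<And>k. M$1$k * curl M$1 + M$2$k * curl M$2 + M$3$k * curl M$3 = 0"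
    and c: "curl M$1 * c$1 + curl M$2 * c$2 + curl M$3 * c$3 = 0"
  shows "classified (aff M c)"
proof -
  define N where "N = transpose B ** M ** B"
  have "(transpose B ** M)$3$k = 0" for k
    using curl[of k] by (simp add: entries B_def) (simp add: algebra_simps)
  then have row: "N$3$k = 0" for k
    by (simp add: N_def matrix_matrix_mult_def[of "transpose B ** M" B])
  have "(M ** B)$k$3 = 0" for k
    using curl[of k] exhaust_3[of k]
    by (auto simp: entries B_def curl_nth algebra_simps)
  then have col: "N$k$3 = 0" for k
    by (simp add: N_def matrix_matrix_mult_def[of "transpose B" "M ** B"] flip: matrix_mul_assoc)
  \<comment> \<open>The left side is the triple product of \<open>u\<close>, \<open>curl M\<close>,
    \<open>v\<close>, so dividing by the determinant leaves the skew part exactly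
    \<open>1/2\<close>.\<close>
  have skewpart: "N$1$2 - N$2$1 = det B"
    by (simp add: N_def entries B_def curl_nth) (simp add: algebra_simps)
  have "(transpose B *v c)$3 = - (curl M$1 * c$1 + curl M$2 * c$2 + curl M$3 * c$3)"
    by (simp add: entries B_def del: transpose_matrix_vector)
  then have third: "(transpose B *v c)$3 = 0" by (simp only: c minus_zero)
  let ?D = "det B"
  have "N = ?D *\<^sub>R mat3 (N$1$1 / ?D) ((N$1$2 / ?D - 1/2) + 1/2) 0
      ((N$1$2 / ?D - 1/2) - 1/2) (N$2$2 / ?D) 0 0 0 0"
    using det skewpart by (simp add: vec_eq_iff forall_3 row col right_diff_distrib)
  moreover have "transpose B *v c
      = ?D *\<^sub>R vector [(transpose B *v c)$1 / ?D, (transpose B *v c)$2 / ?D, 0]"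
    using det third by (simp add: vec_eq_iff forall_3 del: transpose_matrix_vector)
  ultimately show ?thesis
    using classified_congruence[OF classified_block det] unfolding N_def by blast
qed

lemma classified_curl_nonzero:
  assumes "curl M \<noteq> 0"
    and curl: "\<And>k. M$1$k * curl M$1 + M$2$k * curl M$2 + M$3$k * curl M$3 = 0"
    and c: "curl M$1 * c$1 + curl M$2 * c$2 + curl M$3 * c$3 = 0"
  shows "classified (aff M c)"
proof -
  \<comment> \<open>Two coordinate vectors complete the curl to a basis when they omit an axis along
    which it is nonzero.\<close>
  consider "curl M$1 \<noteq> 0" | "curl M$2 \<noteq> 0" | "curl M$3 \<noteq> 0"
    using assms(1) by (auto simp: vec_eq_iff forall_3)
  then show ?thesis
  proof cases
    case 1
    then show ?thesis
      by (intro classified_curl_basis[OF _ curl c, of ddy ddz]) (simp_all add: det_3 axis_def)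
  next
    case 2
    then show ?thesis
      by (intro classified_curl_basis[OF _ curl c, of ddx ddz]) (simp_all add: det_3 axis_def)
  next
    case 3
    then show ?thesis
      by (intro classified_curl_basis[OF _ curl c, of ddx ddy]) (simp_all add: det_3 axis_def)
  qed
qed

section \<open>From affine Poisson structures to matrices\<close>

lemma affine_poisson_imp_aff:
  assumes "affine_poisson \<pi>"
  obtains M c where "\<pi> = aff M c" "\<And>p. curl M \<bullet> (M *v p + c) = 0"
proof -
  obtain L C where L: "linear L" and LC: "\<And>p. \<pi> p = L p + C"
    and poisson: "poisson \<pi>"
    using assms unfolding affine_poisson_def by blast
  \<comment> \<open>\<open>M\<close> and \<open>c\<close> invert \<open>skew\<close> by reading off
    the entries in the cyclic positions (2,3), (3,1), (1,2).\<close>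
  define M :: "real^3^3" where "M = (\<chi> i j. vector [L (axis j 1) $ 2 $ 3, L (axis j 1) $ 3 $ 1, L (axis j 1) $ 1 $ 2] $ i)"
  define c :: "real^3" where "c = vector [C $ 2 $ 3, C $ 3 $ 1, C $ 1 $ 2]"
  have Lp: "L p = p$1 *\<^sub>R L (axis 1 1) + p$2 *\<^sub>R L (axis 2 1) + p$3 *\<^sub>R L (axis 3 1)" for p
  proof -
    have "p = p$1 *\<^sub>R axis 1 1 + p$2 *\<^sub>R axis 2 1 + p$3 *\<^sub>R axis 3 1"
      by (simp add: vec_eq_iff forall_3 axis_def)
    then have "L p = L (p$1 *\<^sub>R axis 1 1 + p$2 *\<^sub>R axis 2 1 + p$3 *\<^sub>R axis 3 1)"
      by (rule arg_cong)
    then show ?thesis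
      by (simp only: linear_add[OF L] linear_scale[OF L])
  qed
  have entry: "\<pi> p $ 2 $ 3 = (M *v p + c) $ 1" "\<pi> p $ 3 $ 1 = (M *v p + c) $ 2"
    "\<pi> p $ 1 $ 2 = (M *v p + c) $ 3" for p
    by (simp_all add: LC Lp[of p] M_def c_def matrix_vector_mult_def sum_3 algebra_simps)
  have antisym: "\<pi> p $ i $ j = - \<pi> p $ j $ i" for p i j
  proof -
    have "transpose (\<pi> p) $ j $ i = (- \<pi> p) $ j $ i"
      using poisson by (simp add: poisson_def bivector_field_def)
    then show ?thesis by (simp add: transpose_def)
  qed
  have "\<pi> p = aff M c p" for p
    using antisym[of p 1 1] antisym[of p 2 2] antisym[of p 3 3]
      antisym[of p 2 1] antisym[of p 3 2] antisym[of p 1 3]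
    by (simp add: vec_eq_iff forall_3 aff_def skew_nth entry)
  then have "\<pi> = aff M c" by blast
  moreover have "curl M \<bullet> (M *v p + c) = 0" for p
  proof -
    have partial: "partial l (\<lambda>q. \<pi> q $ i $ j) p = L (axis l 1) $ i $ j" for l i j
    proof (rule has_derivative_partial)
      have "bounded_linear (\<lambda>h. L h $ i $ j)"
        by (intro linear_conv_bounded_linear[THEN iffD1] linearI)
          (simp_all add: linear_add[OF L] linear_scale[OF L])
      then have "((\<lambda>q. L q $ i $ j + C $ i $ j) has_derivative (\<lambda>h. L h $ i $ j + 0)) (at p)"
        by (intro has_derivative_add bounded_linear_imp_has_derivative has_derivative_const)
      then show "((\<lambda>q. \<pi> q $ i $ j) has_derivative (\<lambda>h. L h $ i $ j)) (at p)"
        by (simp add: LC)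
    qed
    have partials: "partial l (\<lambda>q. \<pi> q $ 2 $ 3) p = M $ 1 $ l"
      "partial l (\<lambda>q. \<pi> q $ 3 $ 1) p = M $ 2 $ l" "partial l (\<lambda>q. \<pi> q $ 1 $ 2) p = M $ 3 $ l" for l
      by (simp_all add: partial M_def)
    have diag: "\<pi> p $ 1 $ 1 = 0" "\<pi> p $ 2 $ 2 = 0" "\<pi> p $ 3 $ 3 = 0"
      using antisym[of p 1 1] antisym[of p 2 2] antisym[of p 3 3] by simp_all
    \<comment> \<open>For the indices 1, 2, 3 the Jacobi sum is minus the inner product of the curl
      with \<open>M *v p + c\<close>.\<close>
    have "(\<Sum>l\<in>UNIV. \<pi> p $ 1 $ l * partial l (\<lambda>q. \<pi> q $ 2 $ 3) p
                    + \<pi> p $ 2 $ l * partial l (\<lambda>q. \<pi> q $ 3 $ 1) p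
                    + \<pi> p $ 3 $ l * partial l (\<lambda>q. \<pi> q $ 1 $ 2) p) = 0"
      using poisson unfolding poisson_def by blast
    note jacobi = this[unfolded partials sum_3 diag antisym[of p 2 1] antisym[of p 3 2]
        antisym[of p 1 3], unfolded entry]
    have "curl M $ 1 * (M *v p + c) $ 1 + curl M $ 2 * (M *v p + c) $ 2
        + curl M $ 3 * (M *v p + c) $ 3 = 0"
      unfolding curl_nth using jacobi by algebra
    then show ?thesis
      by (simp only: inner_vec_def sum_3 inner_real_def)
  qed
  ultimately show thesis by (rule that)
qed

theorem theorem5p3:
  fixes \<pi> :: bivector_field
  assumes "affine_poisson \<pi>"
  shows "(\<exists>\<rho>. normal_form \<rho> \<and> affinely_isomorphic \<pi> \<rho>) \<or>
         (\<exists>\<rho>. split_form \<rho> \<and> affinely_isomorphic \<pi> \<rho>)"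
proof -
  obtain M c where \<pi>: "\<pi> = aff M c" and jacobi: "\<And>p. curl M \<bullet> (M *v p + c) = 0"
    using affine_poisson_imp_aff[OF assms] by blast
  have "classified (aff M c)"
  proof (cases "curl M = 0")
    case True
    then have "transpose M = M"
      by (simp add: curl_def vec_eq_iff forall_3 transpose_def)
    then show ?thesis by (rule classified_symmetric)
  next
    case False
    \<comment> \<open>The identity at the origin concerns \<open>c\<close> alone; subtracting this
      from its values at basis vectors isolates the columns of \<open>M\<close>.\<close>
    have c: "curl M \<bullet> c = 0" using jacobi[of 0] by simp
    have "curl M \<bullet> (M *v axis k 1) = 0" for k
      using jacobi[of "axis k 1"] c by (simp add: inner_add_right)
    with False c show ?thesis
      by (intro classified_curl_nonzero)
        (simp_all add: matrix_vector_mult_basis column_def inner_vec_def sum_3 mult.commute)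
  qed
  then show ?thesis
    unfolding \<pi> classified_def by blast
qed

end
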